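(* (i) For all integers $n\ge4$ and all integers $k$, \begin{align*} E_2(n,k) &= \tfrac{9n^2-9n+2}{2}E_2(n-1,k-3)-\tfrac52E_2(n-1,k-1)+\tfrac{9n^2-36n+35}{2}E_2(n-2,k-4)\\ &\quad+6(n-1)E_2(n-2,k-3)-\tfrac32E_2(n-2,k-2)+3(2n-5)E_2(n-3,k-4)\\ &\quad+\tfrac52E_2(n-3,k-3)+\tfrac52E_2(n-4,k-4). \end{align*} (ii) For all $n\ge4$, $$G_2(n)=\tfrac{9n^2-9n-3}{2}G_2(n-1)+\tfrac{9n^2-24n+20}{2}G_2(n-2)+\left(6n-\tfrac{25}{2}\right)G_2(n-3)+\tfrac52G_2(n-4),$$ and $G_2(0)=1$, $G_2(1)=3$, $G_2(2)=31$, $G_2(3)=842$.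
   Context: For integers $n,k\ge0$, $E_2(n,k)$ is the number of partitions of $\{1,\ldots,k\}$ into exactly $n$ nonempty blocks, each of size at most $3$ ($E_2(0,0)=1$); $E_2(n,k)=0$ if $n$ or $k$ is negative. Gift exchange game with steal limit $\sigma\ge 0$ and $m\ge 1$ gifts: there are $m$ players and $m$ distinct wrapped gifts, initially all in a pool. The players are called one at a time in a fixed order. When a player is called, and also whenever a player's gift has just been stolen, that player (who currently holds no gift) makes a move: either take one of the gifts still in the pool (it is unwrapped and held by that player), or steal an unwrapped gift currently held by another player, provided this gift has so far been stolen fewer than $\sigma$ times in total; the player from whom it was stolen then immediately makes a move. The game ends as soon as the last gift in the pool is taken. A scenario is the complete sequence of moves. For $n\ge 0$, $G_2(n)$ is the number of scenarios of the game with steal limit $\sigma=2$ and $m=n+1$ gifts in which the gifts are taken from the pool in the order $1,2,\ldots,n+1$. *)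

theory Defs
  imports Complex_Main "HOL-Library.Disjoint_Sets"
begin

definition E2 :: "int \<Rightarrow> int \<Rightarrow> nat" where
  "E2 n k = (if n < 0 \<or> k < 0 then 0
     else card {P. partition_on {1..k} P \<and> card P = nat n \<and> (\<forall>B\<in>P. card B \<le> 3)})"

text \<open>
  Gifts and players are numbered from 1. The mover and the victim of a theft are determined by
  the preceding moves, so a move only records the gift concerned.
\<close>

datatype move = Take nat | Steal nat

text \<open>
  The head of \<open>to_move\<close> is the player who has to make the next move; its tail lists the players
  not yet called, in the order in which they will be called. \<open>holder\<close> is defined exactly on the
  unwrapped gifts, and \<open>steals\<close> counts how often a gift has been stolen so far.
\<close>

record state =
  pool :: "nat set"
  holder :: "nat \<Rightarrow> nat option"
  steals :: "nat \<Rightarrow> nat"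
  to_move :: "nat list"

definition initial_state :: "nat \<Rightarrow> state" where
  "initial_state m = \<lparr>pool = {1..m}, holder = Map.empty, steals = (\<lambda>_. 0), to_move = [1..<m+1]\<rparr>"

text \<open>\<open>completes \<sigma> s ms\<close>: with steal limit \<open>\<sigma>\<close>, the moves \<open>ms\<close> lead from state \<open>s\<close> to the end of
  the game.\<close>

inductive completes :: "nat \<Rightarrow> state \<Rightarrow> move list \<Rightarrow> bool" for \<sigma> :: nat where
  game_over: "pool s = {} \<Longrightarrow> completes \<sigma> s []"
| take_gift: "\<lbrakk>g \<in> pool s; to_move s = p # ps;
     completes \<sigma> (s\<lparr>pool := pool s - {g}, holder := (holder s)(g \<mapsto> p), to_move := ps\<rparr>) ms\<rbrakk>
   \<Longrightarrow> completes \<sigma> s (Take g # ms)"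
| steal_gift: "\<lbrakk>pool s \<noteq> {}; to_move s = p # ps; holder s g = Some v; v \<noteq> p; steals s g < \<sigma>;
     completes \<sigma> (s\<lparr>holder := (holder s)(g \<mapsto> p), steals := (steals s)(g := steals s g + 1),
                    to_move := v # ps\<rparr>) ms\<rbrakk>
   \<Longrightarrow> completes \<sigma> s (Steal g # ms)"

definition scenarios :: "nat \<Rightarrow> nat \<Rightarrow> move list set" where
  "scenarios \<sigma> m = {ms. completes \<sigma> (initial_state m) ms}"

fun taken_gifts :: "move list \<Rightarrow> nat list" where
  "taken_gifts [] = []"
| "taken_gifts (Take g # ms) = g # taken_gifts ms"
| "taken_gifts (Steal g # ms) = taken_gifts ms"

definition G2 :: "nat \<Rightarrow> nat" where
  "G2 n = card {ms \<in> scenarios 2 (n+1). taken_gifts ms = [1..<n+2]}"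

end

theory Submission
  imports Defs "HOL-Computational_Algebra.Polynomial"
begin

text \<open>
  Let \<open>f = x + x\<^sup>2/2 + x\<^sup>3/6\<close>. Splitting off the block of one point shows that \<open>E2 n k\<close> is \<open>k!\<close> times
  the \<open>k\<close>-th coefficient of \<open>F\<^sub>n = f^n / n!\<close>. Shifting \<open>k\<close> amounts to differentiating \<open>F\<^sub>n\<close>, so (i)
  says that the fourth derivative of \<open>F\<^sub>n\<close> is a certain combination of derivatives of
  \<open>F\<^sub>n\<^sub>-\<^sub>1, \<dots>, F\<^sub>n\<^sub>-\<^sub>4\<close>; by \<open>F\<^sub>n' = f' F\<^sub>n\<^sub>-\<^sub>1\<close> and \<open>n F\<^sub>n = f F\<^sub>n\<^sub>-\<^sub>1\<close> this is \<open>F\<^sub>n\<^sub>-\<^sub>4\<close> times an identity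
  between polynomials in \<open>x\<close> and rational functions of \<open>n\<close>.

  For (ii), let \<open>L\<close> be the linear functional with \<open>L (x^k) = k!\<close>, so that \<open>L p = p(0) + L p'\<close>. If
  \<open>r + 1\<close> gifts are left in the pool and \<open>a\<close>, \<open>b\<close> of the unwrapped gifts have been stolen \<open>0\<close>, \<open>1\<close>
  times, then the game can be completed in \<open>L (f'^a f''^b F\<^sub>r)\<close> ways, because the product rule for
  this polynomial mirrors the possible moves. Hence \<open>G2 n = L F\<^sub>n\<close>, and \<open>L\<close> maps the identity behind
  (i) to (ii).
\<close>

section \<open>The generating polynomials\<close>

definition block_egf :: "real poly" where
  "block_egf = [:0, 1, 1/2, 1/6:]"

definition partition_egf :: "nat \<Rightarrow> real poly" where
  "partition_egf n = smult (1 / fact n) (block_egf ^ n)"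

lemma pderiv_block_egf: "pderiv block_egf = [:1, 1, 1/2:]"
  by (simp add: block_egf_def pderiv_pCons)

lemma pderiv_partition_egf_0 [simp]: "pderiv (partition_egf 0) = 0"
  by (simp add: partition_egf_def)

lemma pderiv_partition_egf_Suc:
  "pderiv (partition_egf (Suc n)) = [:1, 1, 1/2:] * partition_egf n"
proof -
  have "pderiv (partition_egf (Suc n)) =
      smult (1 / fact (Suc n)) (smult (real (Suc n)) ([:1, 1, 1/2:] * block_egf ^ n))"
    by (simp only: partition_egf_def pderiv_smult pderiv_power_Suc pderiv_block_egf
        mult_smult_left mult.commute)
  also have "\<dots> = smult (1 / fact n) ([:1, 1, 1/2:] * block_egf ^ n)"
    by (simp only: smult_smult fact_Suc) (simp add: divide_simps)
  finally show ?thesis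
    by (simp only: partition_egf_def mult_smult_right)
qed

lemma partition_egf_Suc:
  "smult (real n + 1) (partition_egf (Suc n)) = block_egf * partition_egf n"
proof -
  have "(real n + 1) * (1 / fact (Suc n)) = 1 / fact n"
    unfolding fact_Suc by (simp add: divide_simps)
  then show ?thesis
    by (simp only: partition_egf_def smult_smult mult_smult_right power_Suc)
qed

section \<open>Taylor coefficients with the factorials cleared\<close>

definition egf_coeff :: "real poly \<Rightarrow> nat \<Rightarrow> real" where
  "egf_coeff p k = fact k * coeff p k"

lemma egf_coeff_pderiv: "egf_coeff (pderiv p) k = egf_coeff p (Suc k)"
  by (simp add: egf_coeff_def coeff_pderiv algebra_simps)

lemma egf_coeff_add: "egf_coeff (p + q) k = egf_coeff p k + egf_coeff q k"
  and egf_coeff_diff: "egf_coeff (p - q) k = egf_coeff p k - egf_coeff q k"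
  and egf_coeff_smult: "egf_coeff (smult c p) k = c * egf_coeff p k"
  by (simp_all add: egf_coeff_def algebra_simps)

lemma egf_coeff_partition_egf_0: "egf_coeff (partition_egf 0) k = of_bool (k = 0)"
  by (cases k) (simp_all add: egf_coeff_def partition_egf_def)

text \<open>Since x divides \<open>block_egf\<close>, its n-th power is divisible by x^n.\<close>

lemma coeff_partition_egf_eq_0:
  assumes "k < n"
  shows "coeff (partition_egf n) k = 0"
proof -
  have "block_egf = [:0, 1:] * [:1, 1/2, 1/6:]"
    by (simp add: block_egf_def)
  then have "block_egf ^ n = monom 1 n * [:1, 1/2, 1/6:] ^ n"
    by (metis monom_altdef one_pCons power_mult_distrib smult_1_left)
  then show ?thesis
    using assms by (simp add: partition_egf_def coeff_monom_mult)
qed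

text \<open>A product has the binomial convolution of the two sequences \<open>egf_coeff\<close>,
  and f' has the sequence 1, 1, 1, 0, 0, ...\<close>

lemma egf_coeff_mult_pderiv_block:
  "egf_coeff ([:1, 1, 1/2:] * p) k =
     egf_coeff p k + real k * egf_coeff p (k - 1) + real (k choose 2) * egf_coeff p (k - 2)"
proof (cases "k = 0 \<or> k = 1")
  case True
  \<comment> \<open>Wherever truncated subtraction distorts an index here, the factor
    \<open>real k\<close> or \<open>real (k choose 2)\<close> in front is 0.\<close>
  then show ?thesis
    by (auto simp: egf_coeff_def coeff_pCons)
next
  case False
  then obtain j where k: "k = Suc (Suc j)"
    by (metis One_nat_def not0_implies_Suc)
  have choose: "real (Suc (Suc j) choose 2) = (real j + 2) * (real j + 1) / 2"
    by (induction j) (simp_all add: numeral_2_eq_2 field_simps)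
  show ?thesis
    by (simp add: k egf_coeff_def choose field_simps del: binomial_Suc_Suc)
qed

text \<open>
  With \<open>w = F\<^sub>m(x) / ((m + 1) (m + 2))\<close>, the terms \<open>F0, F1, F2\<close> are the values of
  \<open>F\<^sub>m, F\<^sub>m\<^sub>+\<^sub>1, F\<^sub>m\<^sub>+\<^sub>2\<close> at \<open>x\<close>.
\<close>

lemma partition_egf_recurrence_identity:
  fixes m x w :: real
  defines "n \<equiv> m + 4" and "D \<equiv> 1 + x + x ^ 2 / 2" and "h \<equiv> 1 + x"
    and "f \<equiv> x + x ^ 2 / 2 + x ^ 3 / 6"
  defines "F0 \<equiv> (m + 1) * (m + 2) * w" and "F1 \<equiv> f * (m + 2) * w" and "F2 \<equiv> f ^ 2 * w"
  shows "(4 * D + 3 * h ^ 2) * F2 + 6 * D ^ 2 * h * F1 + D ^ 4 * F0 =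
      (9 * n ^ 2 - 9 * n + 2) / 2 * (D * F2)
      - 5 / 2 * (F2 + 3 * D * h * F1 + D ^ 3 * F0)
      + (9 * n ^ 2 - 36 * n + 35) / 2 * F2
      + 6 * (n - 1) * (D * F1)
      - 3 / 2 * (h * F1 + D ^ 2 * F0)
      + 3 * (2 * n - 5) * F1
      + 5 / 2 * (D * F0)
      + 5 / 2 * F0"
  unfolding n_def D_def h_def f_def F0_def F1_def F2_def
  by (simp add: algebra_simps power2_eq_square power3_eq_cube power4_eq_xxxx
      add_divide_distrib diff_divide_distrib)

lemma partition_egf_recurrence:
  fixes m :: nat
  defines "n \<equiv> real m + 4"
  shows "pderiv (pderiv (pderiv (pderiv (partition_egf (m + 4))))) =
      smult ((9 * n ^ 2 - 9 * n + 2) / 2) (pderiv (partition_egf (m + 3)))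
      - smult (5 / 2) (pderiv (pderiv (pderiv (partition_egf (m + 3)))))
      + smult ((9 * n ^ 2 - 36 * n + 35) / 2) (partition_egf (m + 2))
      + smult (6 * (n - 1)) (pderiv (partition_egf (m + 2)))
      - smult (3 / 2) (pderiv (pderiv (partition_egf (m + 2))))
      + smult (3 * (2 * n - 5)) (partition_egf (m + 1))
      + smult (5 / 2) (pderiv (partition_egf (m + 1)))
      + smult (5 / 2) (partition_egf m)"
    (is "?lhs = ?rhs")
proof -
  define D where "D = [:1, 1, 1/2 :: real:]"
  have D': "pderiv D = [:1, 1:]" "pderiv [:1, 1 :: real:] = 1"
    by (simp_all add: D_def pderiv_pCons)
  have F': "pderiv (partition_egf (m + 1)) = D * partition_egf m"
    "pderiv (partition_egf (m + 2)) = D * partition_egf (m + 1)"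
    "pderiv (partition_egf (m + 3)) = D * partition_egf (m + 2)"
    "pderiv (partition_egf (m + 4)) = D * partition_egf (m + 3)"
    using pderiv_partition_egf_Suc[of m] pderiv_partition_egf_Suc[of "m + 1"]
      pderiv_partition_egf_Suc[of "m + 2"] pderiv_partition_egf_Suc[of "m + 3"]
    by (simp_all add: D_def eval_nat_numeral)
  note simps = pderiv_mult pderiv_add pderiv_1 D' F'
  show ?thesis
  proof (rule poly_ext)
    fix x :: real
    define f where "f = x + x ^ 2 / 2 + x ^ 3 / 6"
    \<comment> \<open>This denominator absorbs the two divisions needed to pass from
      \<open>partition_egf m\<close> to m + 1 and m + 2 by \<open>partition_egf_Suc\<close>.\<close>
    define w where "w = poly (partition_egf m) x / ((real m + 1) * (real m + 2))"
    have nz: "real m + 1 \<noteq> 0" "real m + 2 \<noteq> 0"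
      by linarith+
    then have F0: "poly (partition_egf m) x = (real m + 1) * (real m + 2) * w"
      by (simp add: w_def)
    have f: "poly block_egf x = f"
      by (simp add: f_def block_egf_def power2_eq_square power3_eq_cube field_simps)
    have "(real m + 1) * poly (partition_egf (m + 1)) x = (real m + 1) * (f * (real m + 2) * w)"
      using arg_cong[OF partition_egf_Suc[of m], of "\<lambda>p. poly p x"] by (simp add: f F0)
    then have F1: "poly (partition_egf (m + 1)) x = f * (real m + 2) * w"
      using nz by simp
    have "(real m + 2) * poly (partition_egf (m + 2)) x = (real m + 2) * (f ^ 2 * w)"
      using arg_cong[OF partition_egf_Suc[of "m + 1"], of "\<lambda>p. poly p x"] F1
      by (simp add: f algebra_simps power2_eq_square)
    then have F2: "poly (partition_egf (m + 2)) x = f ^ 2 * w"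
      using nz by simp
    have D: "poly D x = 1 + x + x ^ 2 / 2"
      by (simp add: D_def power2_eq_square field_simps)
    define h where "h = 1 + x"
    have h: "poly [:1, 1:] x = h"
      by (simp add: h_def)
    note poly_simps = poly_add poly_diff poly_mult poly_smult poly_1 poly_0
    \<comment> \<open>As D'' = 1, the third derivative still contains
      \<open>partition_egf (m + 3)\<close> with a constant factor; the fourth is the first to
      involve only the indices m, m + 1, m + 2.\<close>
    have "poly ?lhs x = (4 * poly D x + 3 * h ^ 2) * poly (partition_egf (m + 2)) x +
        6 * poly D x ^ 2 * h * poly (partition_egf (m + 1)) x +
        poly D x ^ 4 * poly (partition_egf m) x"
      unfolding simps poly_simps h by algebra
    also have "\<dots> = poly ?rhs x"
      using partition_egf_recurrence_identity[where x = x and m = "real m" and w = w]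
      unfolding f_def[symmetric] F0[symmetric] F1[symmetric] F2[symmetric]
        n_def[symmetric] D[symmetric]
      unfolding h_def[symmetric]
      unfolding simps poly_simps h
      by (simp add: algebra_simps power2_eq_square power3_eq_cube
          add_divide_distrib diff_divide_distrib)
    finally show "poly ?lhs x = poly ?rhs x" .
  qed
qed

section \<open>Partitions into blocks of bounded size\<close>

text \<open>The ground set is arbitrary because removing a block from an interval need not leave an
  interval.\<close>

definition bounded_partitions :: "nat \<Rightarrow> nat \<Rightarrow> 'a set \<Rightarrow> 'a set set set" where
  "bounded_partitions d n A = {P. partition_on A P \<and> card P = n \<and> (\<forall>B\<in>P. card B \<le> d)}"

lemma bounded_partitions_empty: "bounded_partitions d n {} = (if n = 0 then {{}} else {})"
  by (auto simp: bounded_partitions_def partition_on_empty)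

lemma finite_bounded_partitions: "finite A \<Longrightarrow> finite (bounded_partitions d n A)"
  unfolding bounded_partitions_def
  by (rule finite_subset[OF _ finitely_many_partition_on[of A]]) auto

lemma bounded_partitions_0: "finite A \<Longrightarrow> A \<noteq> {} \<Longrightarrow> bounded_partitions d 0 A = {}"
  by (auto simp: bounded_partitions_def partition_on_def finite_UnionD)

text \<open>\<open>S\<close> is the block of \<open>x\<close> without \<open>x\<close>, which makes
  its size bound strict. Deleting this block and inserting it are inverse to each other.\<close>

lemma bounded_partitions_Suc_insert:
  assumes "finite A" "x \<notin> A"
  shows "bounded_partitions d (Suc n) (insert x A) =
    (\<Union>S\<in>{S. S \<subseteq> A \<and> card S < d}. insert (insert x S) ` bounded_partitions d n (A - S))"
    (is "?L = ?R")
proof (intro equalityI subsetI)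
  fix P assume "P \<in> ?L"
  then have P: "partition_on (insert x A) P" "card P = Suc n" "\<And>B. B \<in> P \<Longrightarrow> card B \<le> d"
    by (auto simp: bounded_partitions_def)
  then obtain B where B: "B \<in> P" "x \<in> B"
    by (auto simp: partition_on_def)
  define S where "S = B - {x}"
  have "B \<subseteq> insert x A"
    using P(1) B by (auto simp: partition_on_def)
  then have S: "S \<subseteq> A" "B = insert x S" "x \<notin> S"
    using B by (auto simp: S_def)
  then have "finite S"
    using assms by (auto intro: finite_subset)
  then have "card S < d"
    using P(3)[OF B(1)] S by simp
  have "partition_on (insert x A - B) (P - {B})"
    using P(1) B(1) by (auto simp: partition_on_def disjoint_def)
  moreover have "insert x A - B = A - S"
    using S assms by auto
  moreover have "card (P - {B}) = n"
    using P(2) B(1) by simp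
  ultimately have "P - {B} \<in> bounded_partitions d n (A - S)"
    using P(3) by (auto simp: bounded_partitions_def)
  moreover have "P = insert (insert x S) (P - {B})"
    using B S by auto
  ultimately show "P \<in> ?R"
    using S(1) \<open>card S < d\<close> by blast
next
  fix P assume "P \<in> ?R"
  then obtain S Q where S: "S \<subseteq> A" "card S < d" and P: "P = insert (insert x S) Q"
    and Q: "partition_on (A - S) Q" "card Q = n" "\<And>B. B \<in> Q \<Longrightarrow> card B \<le> d"
    by (auto simp: bounded_partitions_def)
  have fin: "finite Q" "finite S"
    using Q(1) S(1) assms(1) by (auto intro: finite_elements finite_subset)
  have "partition_on (insert x A) P"
    unfolding P using Q(1) S(1) assms(2) by (auto simp: partition_on_def disjoint_def)
  \<comment> \<open>No block of \<open>Q\<close> contains \<open>x\<close>, so the inserted block is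
    new and raises the cardinality.\<close>
  moreover have "insert x S \<notin> Q"
    using Q(1) assms(2) by (auto simp: partition_on_def)
  then have "card P = Suc n"
    using Q(2) fin by (simp add: P)
  moreover have "card (insert x S) \<le> d"
    using S(2) fin by (metis Suc_leI card_insert_if less_imp_le_nat)
  ultimately show "P \<in> ?L"
    using Q(3) by (auto simp: bounded_partitions_def P)
qed

text \<open>The block containing \<open>x\<close> can be read off the partition, which determines
  both \<open>S\<close> and the remaining blocks. Hence the union is disjoint and each insertion map
  injective.\<close>

lemma card_bounded_partitions_Suc_insert:
  assumes "finite A" "x \<notin> A"
  shows "card (bounded_partitions d (Suc n) (insert x A)) =
    (\<Sum>S\<in>{S. S \<subseteq> A \<and> card S < d}. card (bounded_partitions d n (A - S)))"
proof -
  have x_notin: "x \<notin> \<Union>Q" if "Q \<in> bounded_partitions d n (A - S)" for Q S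
    using that assms(2) by (auto simp: bounded_partitions_def partition_on_def)
  have "card (bounded_partitions d (Suc n) (insert x A)) =
    (\<Sum>S\<in>{S. S \<subseteq> A \<and> card S < d}. card (insert (insert x S) ` bounded_partitions d n (A - S)))"
    unfolding bounded_partitions_Suc_insert[OF assms]
  proof (rule card_UN_disjoint)
    show "finite {S. S \<subseteq> A \<and> card S < d}"
      using assms(1) by auto
    show "\<forall>S\<in>{S. S \<subseteq> A \<and> card S < d}.
        finite (insert (insert x S) ` bounded_partitions d n (A - S))"
      using assms(1) by (auto intro: finite_bounded_partitions)
    show "\<forall>S\<in>{S. S \<subseteq> A \<and> card S < d}. \<forall>T\<in>{S. S \<subseteq> A \<and> card S < d}. S \<noteq> T \<longrightarrow>
        insert (insert x S) ` bounded_partitions d n (A - S) \<inter>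
        insert (insert x T) ` bounded_partitions d n (A - T) = {}"
    proof (intro ballI impI equals0I)
      fix S T P
      assume ST: "S \<in> {S. S \<subseteq> A \<and> card S < d}" "T \<in> {S. S \<subseteq> A \<and> card S < d}" "S \<noteq> T"
        and "P \<in> insert (insert x S) ` bounded_partitions d n (A - S) \<inter>
          insert (insert x T) ` bounded_partitions d n (A - T)"
      then obtain Q R where P: "P = insert (insert x S) Q" "P = insert (insert x T) R"
        and "Q \<in> bounded_partitions d n (A - S)" "R \<in> bounded_partitions d n (A - T)"
        by (elim IntE imageE)
      then have "x \<notin> \<Union>R"
        by (intro x_notin)
      moreover have "insert x S \<in> insert (insert x T) R"
        using P by auto
      ultimately have "insert x S = insert x T"
        by auto
      moreover have "x \<notin> S" "x \<notin> T"
        using ST assms(2) by auto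
      ultimately show False
        using ST(3) insert_ident by metis
    qed
  qed
  also have "\<dots> = (\<Sum>S\<in>{S. S \<subseteq> A \<and> card S < d}. card (bounded_partitions d n (A - S)))"
  proof (intro sum.cong refl card_image inj_onI)
    fix S Q R
    assume "Q \<in> bounded_partitions d n (A - S)" "R \<in> bounded_partitions d n (A - S)"
      and eq: "insert (insert x S) Q = insert (insert x S) R"
    then have "x \<notin> \<Union>Q" "x \<notin> \<Union>R"
      by (simp_all only: x_notin not_False_eq_True)
    then have "insert x S \<notin> Q" "insert x S \<notin> R"
      by auto
    then show "Q = R"
      using eq by (metis insert_ident)
  qed
  finally show ?thesis .
qed

lemma sum_subsets_card_less:
  fixes h :: "nat \<Rightarrow> 'b::comm_semiring_1"
  assumes "finite A"
  shows "(\<Sum>S\<in>{S. S \<subseteq> A \<and> card S < d}. h (card S)) = (\<Sum>j<d. of_nat (card A choose j) * h j)"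
proof -
  have "(\<Sum>S\<in>{S. S \<subseteq> A \<and> card S < d}. h (card S)) =
    (\<Sum>j<d. \<Sum>S\<in>{S \<in> {S. S \<subseteq> A \<and> card S < d}. card S = j}. h (card S))"
    using assms by (intro sum.group[symmetric]) auto
  also have "\<dots> = (\<Sum>j<d. of_nat (card A choose j) * h j)"
  proof (rule sum.cong)
    fix j assume "j \<in> {..<d}"
    then have "{S \<in> {S. S \<subseteq> A \<and> card S < d}. card S = j} = {S. S \<subseteq> A \<and> card S = j}"
      by auto
    then show "(\<Sum>S\<in>{S \<in> {S. S \<subseteq> A \<and> card S < d}. card S = j}. h (card S)) =
        of_nat (card A choose j) * h j"
      by (simp add: n_subsets[OF assms])
  qed simp
  finally show ?thesis .
qed

text \<open>Splitting off a block with j + 1 points, j < 3, gives the counts the same recursion as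
  the product F' = f' F gives the coefficients.\<close>

lemma card_bounded_partitions_3:
  assumes "finite A"
  shows "real (card (bounded_partitions 3 n A)) = egf_coeff (partition_egf n) (card A)"
  using assms
proof (induction n arbitrary: A)
  case 0
  then show ?case
    by (cases "A = {}")
      (simp_all add: bounded_partitions_empty bounded_partitions_0 egf_coeff_partition_egf_0)
next
  case (Suc n)
  show ?case
  proof (cases "A = {}")
    case True
    \<comment> \<open>The empty set has no partition into n + 1 blocks, and
      \<open>partition_egf (Suc n)\<close> has constant term 0.\<close>
    then show ?thesis
      by (simp add: bounded_partitions_empty egf_coeff_def coeff_partition_egf_eq_0)
  next
    case False
    then obtain x B where A: "A = insert x B" "x \<notin> B"
      by (metis Set.set_insert ex_in_conv)
    then have "finite B"
      using Suc.prems by simp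
    let ?e = "egf_coeff (partition_egf n)"
    have "real (card (bounded_partitions 3 (Suc n) A)) =
      (\<Sum>S\<in>{S. S \<subseteq> B \<and> card S < 3}. real (card (bounded_partitions 3 n (B - S))))"
      using card_bounded_partitions_Suc_insert[OF \<open>finite B\<close> A(2)] by (simp add: A(1))
    also have "\<dots> = (\<Sum>S\<in>{S. S \<subseteq> B \<and> card S < 3}. ?e (card B - card S))"
      using \<open>finite B\<close> by (intro sum.cong)
        (auto simp: Suc.IH card_Diff_subset finite_subset)
    also have "\<dots> = (\<Sum>j<3. real (card B choose j) * ?e (card B - j))"
      by (rule sum_subsets_card_less[OF \<open>finite B\<close>])
    also have "\<dots> = egf_coeff ([:1, 1, 1/2:] * partition_egf n) (card B)"
      unfolding egf_coeff_mult_pderiv_block by (simp add: eval_nat_numeral)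
    \<comment> \<open>The index shift of the derivative accounts for the split-off point
      \<open>x\<close>.\<close>
    also have "\<dots> = egf_coeff (partition_egf (Suc n)) (card A)"
      unfolding pderiv_partition_egf_Suc[symmetric] egf_coeff_pderiv
      using A \<open>finite B\<close> by simp
    finally show ?thesis .
  qed
qed

section \<open>The numbers \<open>E2\<close> and their recurrence\<close>

lemma E2_eq_egf_coeff: "real (E2 (int n) (int k)) = egf_coeff (partition_egf n) k"
  using card_bounded_partitions_3[of "{1..int k}" n] by (simp add: E2_def bounded_partitions_def)

lemma E2_eq_0: "k < n \<Longrightarrow> E2 n k = 0"
proof (cases "k < 0")
  case False
  assume "k < n"
  then have "real (E2 (int (nat n)) (int (nat k))) = 0"
    using False by (subst E2_eq_egf_coeff) (simp add: egf_coeff_def coeff_partition_egf_eq_0)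
  then show "E2 n k = 0"
    using False \<open>k < n\<close> by simp
qed (simp add: E2_def)

lemma E2_recurrence:
  fixes n k :: int
  assumes "n \<ge> 4"
  shows "real (E2 n k) =
        (9 * of_int n ^ 2 - 9 * of_int n + 2) / 2 * real (E2 (n - 1) (k - 3))
        - 5 / 2 * real (E2 (n - 1) (k - 1))
        + (9 * of_int n ^ 2 - 36 * of_int n + 35) / 2 * real (E2 (n - 2) (k - 4))
        + 6 * (of_int n - 1) * real (E2 (n - 2) (k - 3))
        - 3 / 2 * real (E2 (n - 2) (k - 2))
        + 3 * (2 * of_int n - 5) * real (E2 (n - 3) (k - 4))
        + 5 / 2 * real (E2 (n - 3) (k - 3))
        + 5 / 2 * real (E2 (n - 4) (k - 4))"
proof (cases "k < 4")
  case True
  \<comment> \<open>Every term lowers k at least as much as n, so the second argument stays below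
    the first and all terms vanish.\<close>
  then show ?thesis
    using assms by (simp add: E2_eq_0)
next
  case False
  \<comment> \<open>Coefficient \<open>j\<close> is compared: an i-fold derivative contributes index
    k - 4 + i.\<close>
  define m j where "m = nat (n - 4)" and "j = nat (k - 4)"
  have n: "n = int (m + 4)" "n - 1 = int (m + 3)" "n - 2 = int (m + 2)" "n - 3 = int (m + 1)"
      "n - 4 = int m"
    and k: "k = int (j + 4)" "k - 1 = int (j + 3)" "k - 2 = int (j + 2)" "k - 3 = int (j + 1)"
      "k - 4 = int j"
    using assms False by (simp_all add: m_def j_def)
  have real_n: "real_of_int n = real m + 4"
    using n(1) by simp
  have k': "j + 4 = Suc (Suc (Suc (Suc j)))" "j + 3 = Suc (Suc (Suc j))" "j + 2 = Suc (Suc j)"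
      "j + 1 = Suc j"
    by simp_all
  show ?thesis
    unfolding real_n unfolding n(2-5) k(2-5) unfolding n(1) k(1) unfolding E2_eq_egf_coeff
    using arg_cong[OF partition_egf_recurrence[of m], of "\<lambda>p. egf_coeff p j"]
    unfolding egf_coeff_add egf_coeff_diff egf_coeff_smult egf_coeff_pderiv k' .
qed

section \<open>The functional sending \<open>x^k\<close> to \<open>k!\<close>\<close>

text \<open>This is the integral of p(x) exp(-x) over x \<ge> 0.\<close>

definition laplace :: "real poly \<Rightarrow> real" where
  "laplace p = (\<Sum>k\<le>degree p. egf_coeff p k)"

lemma laplace_eq_sum: "degree p \<le> N \<Longrightarrow> laplace p = (\<Sum>k\<le>N. egf_coeff p k)"
  unfolding laplace_def
  by (rule sum.mono_neutral_left) (auto simp: egf_coeff_def coeff_eq_0)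

lemma laplace_0 [simp]: "laplace 0 = 0"
  by (simp add: laplace_def egf_coeff_def)

lemma laplace_add: "laplace (p + q) = laplace p + laplace q"
proof -
  let ?N = "max (degree p) (degree q)"
  have "degree (p + q) \<le> ?N"
    by (rule degree_add_le_max)
  then show ?thesis
    by (simp add: laplace_eq_sum[of _ ?N] egf_coeff_add sum.distrib)
qed

lemma laplace_smult: "laplace (smult c p) = c * laplace p"
  by (subst laplace_eq_sum[of _ "degree p"])
    (simp_all add: egf_coeff_smult sum_distrib_left laplace_def)

lemma laplace_diff: "laplace (p - q) = laplace p - laplace q"
  using laplace_add[of p "smult (-1) q"] laplace_smult[of "-1" q] by simp

text \<open>Integration by parts: differentiating shifts the sequence \<open>egf_coeff\<close> and
  loses only its entry at 0.\<close>

lemma laplace_pderiv: "laplace p = coeff p 0 + laplace (pderiv p)"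
proof -
  have "laplace p = (\<Sum>k\<le>Suc (degree p). egf_coeff p k)"
    by (rule laplace_eq_sum) simp
  also have "\<dots> = coeff p 0 + (\<Sum>k\<le>degree p. egf_coeff (pderiv p) k)"
    by (subst sum.atMost_Suc_shift) (simp add: egf_coeff_pderiv, simp add: egf_coeff_def)
  also have "(\<Sum>k\<le>degree p. egf_coeff (pderiv p) k) = laplace (pderiv p)"
    by (rule laplace_eq_sum[symmetric]) (simp add: degree_pderiv)
  finally show ?thesis .
qed

text \<open>Divisibility by x^n makes the boundary terms at 0 of the first n integrations by parts
  vanish.\<close>

lemma laplace_funpow_pderiv_partition_egf:
  "j \<le> n \<Longrightarrow> laplace ((pderiv ^^ j) (partition_egf n)) = laplace (partition_egf n)"
proof (induction j)
  case (Suc j)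
  have "egf_coeff ((pderiv ^^ j) p) k = egf_coeff p (k + j)" for p k
    by (induction j arbitrary: k) (simp_all add: egf_coeff_pderiv)
  from this[of "partition_egf n" 0] have "coeff ((pderiv ^^ j) (partition_egf n)) 0 = 0"
    using Suc.prems by (simp add: egf_coeff_def coeff_partition_egf_eq_0)
  then show ?case
    using Suc laplace_pderiv[of "(pderiv ^^ j) (partition_egf n)"] by simp
qed simp

text \<open>In \<open>partition_egf_recurrence\<close> no polynomial is differentiated more often
  than its index, so all derivatives of the same polynomial have equal values and their coefficients
  add up.\<close>

lemma laplace_partition_egf_recurrence:
  assumes "n \<ge> 4"
  shows "laplace (partition_egf n) =
      (9 * real n ^ 2 - 9 * real n - 3) / 2 * laplace (partition_egf (n - 1))
      + (9 * real n ^ 2 - 24 * real n + 20) / 2 * laplace (partition_egf (n - 2))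
      + (6 * real n - 25 / 2) * laplace (partition_egf (n - 3))
      + 5 / 2 * laplace (partition_egf (n - 4))"
proof -
  define m where "m = n - 4"
  have n: "n = m + 4" "n - 1 = m + 3" "n - 2 = m + 2" "n - 3 = m + 1" "n - 4 = m"
    using assms by (simp_all add: m_def)
  define G where "G = (\<lambda>n. laplace (partition_egf n))"
  have fold_G: "laplace (partition_egf n) = G n" for n
    by (simp add: G_def)
  have shift: "j \<le> n \<Longrightarrow> laplace ((pderiv ^^ j) (partition_egf n)) = G n" for j n
    unfolding G_def by (rule laplace_funpow_pderiv_partition_egf)
  have G: "laplace (pderiv (pderiv (pderiv (pderiv (partition_egf (m + 4)))))) = G (m + 4)"
    "laplace (pderiv (pderiv (pderiv (partition_egf (m + 3))))) = G (m + 3)"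
    "laplace (pderiv (partition_egf (m + 3))) = G (m + 3)"
    "laplace (pderiv (pderiv (partition_egf (m + 2)))) = G (m + 2)"
    "laplace (pderiv (partition_egf (m + 2))) = G (m + 2)"
    "laplace (partition_egf (m + 2)) = G (m + 2)"
    "laplace (pderiv (partition_egf (m + 1))) = G (m + 1)"
    "laplace (partition_egf (m + 1)) = G (m + 1)"
    "laplace (partition_egf m) = G m"
    using shift[of 4 "m + 4"] shift[of 3 "m + 3"] shift[of 1 "m + 3"] shift[of 2 "m + 2"]
      shift[of 1 "m + 2"] shift[of 1 "m + 1"]
    by (simp_all add: eval_nat_numeral G_def)
  show ?thesis
    using arg_cong[OF partition_egf_recurrence[of m], of laplace]
    unfolding laplace_add laplace_diff laplace_smult G unfolding n(2-5) unfolding n(1)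
    unfolding fold_G
    by (simp add: field_simps power2_eq_square)
qed

section \<open>Counting the scenarios\<close>

definition completions :: "nat \<Rightarrow> nat \<Rightarrow> nat \<Rightarrow> real" where
  "completions a b r = laplace ([:1, 1, 1/2:] ^ a * [:1, 1:] ^ b * partition_egf r)"

text \<open>Product rule: F_r' = f' F_(r-1) is taking a gift, f' turning into f'' a first theft, f''
  turning into 1 a second one. For \<open>r = 0\<close> the constant term 1 counts the take that
  ends the game. Where \<open>a - 1\<close> or \<open>b - 1\<close> truncates, its factor is
  0.\<close>

lemma completions_rec:
  "completions a b r =
     (case r of 0 \<Rightarrow> 1 | Suc r' \<Rightarrow> completions (Suc a) b r')
     + real a * completions (a - 1) (Suc b) r + real b * completions a (b - 1) r"
proof -
  define D :: "real poly" where "D = [:1, 1, 1/2:]"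
  define h :: "real poly" where "h = [:1, 1:]"
  have D': "pderiv D = h" and h': "pderiv h = 1"
    by (simp_all add: D_def h_def pderiv_pCons)
  have pow: "pderiv (D ^ a) = smult (real a) (D ^ (a - 1) * h)"
      "pderiv (h ^ b) = smult (real b) (h ^ (b - 1))"
    by (simp_all add: pderiv_power D' h')
  have "pderiv (D ^ a * h ^ b * partition_egf r) =
      D ^ a * h ^ b * pderiv (partition_egf r)
      + smult (real a) (D ^ (a - 1) * h ^ Suc b * partition_egf r)
      + smult (real b) (D ^ a * h ^ (b - 1) * partition_egf r)"
    by (simp add: pderiv_mult pow algebra_simps)
  moreover have "coeff (D ^ a * h ^ b * partition_egf r) 0 +
        laplace (D ^ a * h ^ b * pderiv (partition_egf r))
      = (case r of 0 \<Rightarrow> 1 | Suc r' \<Rightarrow> completions (Suc a) b r')"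
  proof (cases r)
    case 0
    then show ?thesis
      by (simp add: coeff_mult_0 coeff_0_power D_def h_def partition_egf_def)
  next
    case (Suc r')
    then show ?thesis
      by (simp add: coeff_mult_0 coeff_partition_egf_eq_0 pderiv_partition_egf_Suc completions_def
          flip: D_def h_def) (simp add: mult_ac)
  qed
  ultimately show ?thesis
    using laplace_pderiv[of "D ^ a * h ^ b * partition_egf r"]
    by (simp add: completions_def laplace_add laplace_smult flip: D_def h_def)
qed

section \<open>Game states and the moves between them\<close>

definition take_state :: "nat \<Rightarrow> state \<Rightarrow> state" where
  "take_state g s = s\<lparr>pool := pool s - {g}, holder := (holder s)(g \<mapsto> hd (to_move s)),
     to_move := tl (to_move s)\<rparr>"

text \<open>Like \<open>take_state\<close>, a total function; it agrees with the rule of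
  \<open>completes\<close> when some player is to move and \<open>g\<close> is held.\<close>

definition steal_state :: "nat \<Rightarrow> state \<Rightarrow> state" where
  "steal_state g s = s\<lparr>holder := (holder s)(g \<mapsto> hd (to_move s)),
     steals := (steals s)(g := steals s g + 1),
     to_move := the (holder s g) # tl (to_move s)\<rparr>"

text \<open>Here \<open>i\<close> is the next gift to be taken from the pool, or \<open>m + 1\<close> if the pool is empty.\<close>

definition valid_state :: "nat \<Rightarrow> nat \<Rightarrow> state \<Rightarrow> bool" where
  "valid_state m i s \<longleftrightarrow>
     1 \<le> i \<and> pool s = {i..m} \<and> dom (holder s) = {1..<i} \<and> inj_on (holder s) {1..<i} \<and>
     length (to_move s) = Suc m - i \<and> distinct (to_move s) \<and>
     ran (holder s) \<inter> set (to_move s) = {} \<and> (\<forall>g\<ge>i. steals s g = 0)"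

definition stolen_times :: "nat \<Rightarrow> nat \<Rightarrow> state \<Rightarrow> nat set" where
  "stolen_times j i s = {g \<in> {1..<i}. steals s g = j}"

definition ordered_completions :: "nat \<Rightarrow> nat \<Rightarrow> state \<Rightarrow> move list set" where
  "ordered_completions m i s = {ms. completes 2 s ms \<and> taken_gifts ms = [i..<Suc m]}"

lemma finite_stolen_times [simp]: "finite (stolen_times j i s)"
  by (simp add: stolen_times_def)

text \<open>In a valid state as many players wait as gifts are in the pool.\<close>

lemma valid_state_to_move:
  assumes "valid_state m i s" "i \<le> m"
  obtains p ps where "to_move s = p # ps"
  using assms by (cases "to_move s") (auto simp: valid_state_def)

lemma valid_take_state:
  assumes valid: "valid_state m i s" and "i \<le> m"
  shows "valid_state m (Suc i) (take_state i s)"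
proof -
  obtain p ps where p: "to_move s = p # ps"
    using valid_state_to_move[OF assms] .
  have dom: "dom (holder s) = {1..<i}" and "1 \<le> i"
    using valid by (auto simp: valid_state_def)
  then have "holder s i = None"
    by (auto simp: dom_def)
  have "p \<notin> ran (holder s)"
    using valid p by (auto simp: valid_state_def)
  then have "inj_on ((holder s)(i \<mapsto> p)) (insert i {1..<i})"
    using valid by (auto simp: valid_state_def inj_on_def ran_def)
  moreover have insert_i: "insert i {1..<i} = {1..<Suc i}"
    using \<open>1 \<le> i\<close> by auto
  ultimately have "inj_on ((holder s)(i \<mapsto> p)) {1..<Suc i}"
    by metis
  moreover have "{i..m} - {i} = {Suc i..m}"
    by auto
  ultimately show ?thesis
    using valid \<open>holder s i = None\<close> insert_i by (auto simp: valid_state_def take_state_def p)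
qed

lemma valid_steal_state:
  assumes valid: "valid_state m i s" and "i \<le> m" and g: "g \<in> {1..<i}"
  shows "valid_state m i (steal_state g s)"
proof -
  obtain p ps where p: "to_move s = p # ps"
    using valid_state_to_move[OF assms(1,2)] .
  have dom: "dom (holder s) = {1..<i}" and inj: "inj_on (holder s) {1..<i}"
    using valid by (auto simp: valid_state_def)
  obtain v where v: "holder s g = Some v"
    using g dom by blast
  have p_ran: "p \<notin> ran (holder s)" and ps_ran: "ran (holder s) \<inter> set ps = {}"
    using valid p by (auto simp: valid_state_def)
  have v_ran: "v \<in> ran (holder s)"
    using v by (auto simp: ran_def)
  \<comment> \<open>Injectivity of \<open>holder s\<close> leaves the victim without any gift, as
    the next mover must be.\<close>
  have unique: "g' = g" if "holder s g' = Some v" for g'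
    using that inj_onD[OF inj, of g' g] v g dom by (metis domI)
  have "ran ((holder s)(g \<mapsto> p)) \<subseteq> insert p (ran (holder s) - {v})"
    using unique by (auto simp: ran_def split: if_splits)
  moreover have "inj_on ((holder s)(g \<mapsto> p)) {1..<i}"
    using inj p_ran by (auto simp: inj_on_def ran_def)
  moreover have "insert g {1..<i} = {1..<i}"
    using g by auto
  moreover have "p \<notin> set ps" "distinct ps"
    using valid p by (auto simp: valid_state_def)
  ultimately show ?thesis
    using valid g v_ran p_ran ps_ran
    by (auto simp: valid_state_def steal_state_def p v)
qed

lemma ordered_completions_end:
  assumes "valid_state m (Suc m) s"
  shows "ordered_completions m (Suc m) s = {[]}"
  using assms by (auto simp: ordered_completions_def valid_state_def
      intro: completes.game_over elim: completes.cases)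

text \<open>The prescribed order forces a take to be of gift \<open>i\<close>. Every unwrapped gift
  is held by someone other than the mover, so only the steal limit restricts thefts.\<close>

lemma ordered_completions_step:
  assumes valid: "valid_state m i s" and "i \<le> m"
  shows "ordered_completions m i s =
    Cons (Take i) ` ordered_completions m (Suc i) (take_state i s) \<union>
    (\<Union>g\<in>stolen_times 0 i s \<union> stolen_times 1 i s.
       Cons (Steal g) ` ordered_completions m i (steal_state g s))"
    (is "?L = ?R")
proof (intro equalityI subsetI)
  obtain p ps where p: "to_move s = p # ps"
    using valid_state_to_move[OF assms] .
  have dom: "dom (holder s) = {1..<i}" and pool: "pool s = {i..m}"
    using valid by (auto simp: valid_state_def)
  have upt: "[i..<Suc m] = i # [Suc i..<Suc m]"
    using \<open>i \<le> m\<close> by (simp add: upt_rec)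
  {
    fix ms assume "ms \<in> ?L"
    then have "completes 2 s ms" and taken: "taken_gifts ms = [i..<Suc m]"
      by (auto simp: ordered_completions_def)
    from this(1) show "ms \<in> ?R"
    proof cases
      case game_over
      then show ?thesis
        using pool \<open>i \<le> m\<close> by auto
    next
      case (take_gift g q qs ms')
      then have "g = i" "taken_gifts ms' = [Suc i..<Suc m]"
        using taken unfolding upt by auto
      then show ?thesis
        using take_gift by (auto simp: ordered_completions_def take_state_def simp del: upt_Suc)
    next
      case (steal_gift q qs g v ms')
      have "g \<in> {1..<i}"
        using steal_gift(4) dom by blast
      then have "g \<in> stolen_times 0 i s \<union> stolen_times 1 i s"
        using steal_gift(6) by (auto simp: stolen_times_def)
      moreover have "ms' \<in> ordered_completions m i (steal_state g s)"
        using steal_gift taken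
        by (auto simp: ordered_completions_def steal_state_def simp del: upt_Suc)
      ultimately show ?thesis
        using steal_gift(1) by blast
    qed
  }
  {
    fix ms assume "ms \<in> ?R"
    then show "ms \<in> ?L"
    proof
      assume "ms \<in> Cons (Take i) ` ordered_completions m (Suc i) (take_state i s)"
      then obtain ms' where "ms = Take i # ms'" "completes 2 (take_state i s) ms'"
          "taken_gifts ms' = [Suc i..<Suc m]"
        by (auto simp: ordered_completions_def)
      then show ?thesis
        using completes.take_gift[of i s p ps 2 ms'] p pool \<open>i \<le> m\<close>
        unfolding ordered_completions_def upt by (simp add: take_state_def)
    next
      assume "ms \<in> (\<Union>g\<in>stolen_times 0 i s \<union> stolen_times 1 i s.
          Cons (Steal g) ` ordered_completions m i (steal_state g s))"
      then obtain g ms' where g: "g \<in> stolen_times 0 i s \<union> stolen_times 1 i s"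
          and ms': "ms = Steal g # ms'" "completes 2 (steal_state g s) ms'"
            "taken_gifts ms' = [i..<Suc m]"
        by (auto simp: ordered_completions_def)
      have "g \<in> {1..<i}" "steals s g < 2"
        using g by (auto simp: stolen_times_def)
      then obtain v where v: "holder s g = Some v"
        using dom by blast
      then have "v \<noteq> p"
        using valid p by (auto simp: valid_state_def ran_def)
      then show ?thesis
        using completes.steal_gift[of s p ps g v 2 ms'] p v pool \<open>i \<le> m\<close> \<open>steals s g < 2\<close> ms'
        unfolding ordered_completions_def by (simp add: steal_state_def del: upt_Suc)
    qed
  }
qed

text \<open>Validity says that gifts still in the pool have never been stolen.\<close>

lemma stolen_times_take_state:
  assumes "valid_state m i s"
  shows "stolen_times 0 (Suc i) (take_state i s) = insert i (stolen_times 0 i s)"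
    and "stolen_times 1 (Suc i) (take_state i s) = stolen_times 1 i s"
  using assms
  by (auto simp: valid_state_def stolen_times_def take_state_def less_Suc_eq)

lemma card_stolen_times_steal_state_0:
  assumes "g \<in> stolen_times 0 i s"
  shows "card (stolen_times 0 i (steal_state g s)) = card (stolen_times 0 i s) - 1"
    and "card (stolen_times 1 i (steal_state g s)) = Suc (card (stolen_times 1 i s))"
proof -
  have "stolen_times 0 i (steal_state g s) = stolen_times 0 i s - {g}"
    using assms by (auto simp: stolen_times_def steal_state_def)
  then show "card (stolen_times 0 i (steal_state g s)) = card (stolen_times 0 i s) - 1"
    using assms by simp
  have "stolen_times 1 i (steal_state g s) = insert g (stolen_times 1 i s)"
      and "g \<notin> stolen_times 1 i s"
    using assms by (auto simp: stolen_times_def steal_state_def)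
  then show "card (stolen_times 1 i (steal_state g s)) = Suc (card (stolen_times 1 i s))"
    by simp
qed

lemma card_stolen_times_steal_state_1:
  assumes "g \<in> stolen_times 1 i s"
  shows "card (stolen_times 0 i (steal_state g s)) = card (stolen_times 0 i s)"
    and "card (stolen_times 1 i (steal_state g s)) = card (stolen_times 1 i s) - 1"
proof -
  have "stolen_times 0 i (steal_state g s) = stolen_times 0 i s"
    using assms by (auto simp: stolen_times_def steal_state_def)
  then show "card (stolen_times 0 i (steal_state g s)) = card (stolen_times 0 i s)"
    by simp
  have "stolen_times 1 i (steal_state g s) = stolen_times 1 i s - {g}"
    using assms by (auto simp: stolen_times_def steal_state_def)
  then show "card (stolen_times 1 i (steal_state g s)) = card (stolen_times 1 i s) - 1"
    using assms by simp
qed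

text \<open>Both sides satisfy the recursion \<open>completions_rec\<close>. The last argument is
  \<open>m - i\<close> because the pool holds m - i + 1 gifts. Finiteness is proved along with the
  count to justify adding cardinalities.\<close>

lemma card_ordered_completions:
  assumes "valid_state m i s" "i \<le> m"
  shows "finite (ordered_completions m i s) \<and>
    real (card (ordered_completions m i s)) =
      completions (card (stolen_times 0 i s)) (card (stolen_times 1 i s)) (m - i)"
  using assms
\<comment> \<open>An unwrapped gift weighs the number of thefts it still allows, a pooled gift other
  than the last weighs 3; each move before the last take lowers the total by 1.\<close>
proof (induction "3 * (m - i) + 2 * card (stolen_times 0 i s) + card (stolen_times 1 i s)"
    arbitrary: i s rule: less_induct)
  case (less i s)
  let ?U = "\<lambda>j. stolen_times j i s"
  let ?a = "card (?U 0)" and ?b = "card (?U 1)"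
  let ?C = "\<lambda>g. ordered_completions m i (steal_state g s)"
  let ?T = "ordered_completions m (Suc i) (take_state i s)"
  have disj: "?U 0 \<inter> ?U 1 = {}"
    by (auto simp: stolen_times_def)
  have steal_0: "finite (?C g) \<and> real (card (?C g)) = completions (?a - 1) (Suc ?b) (m - i)"
    if g: "g \<in> ?U 0" for g
  proof -
    have "g \<in> {1..<i}"
      using g by (simp add: stolen_times_def)
    \<comment> \<open>Ensures that \<open>?a - 1\<close> is a genuine decrease of the
      measure.\<close>
    moreover have "?a > 0"
      using g by (auto simp: card_gt_0_iff)
    ultimately show ?thesis
      using less.hyps[of i "steal_state g s"] less.prems card_stolen_times_steal_state_0[OF g]
      by (simp add: valid_steal_state)
  qed
  have steal_1: "finite (?C g) \<and> real (card (?C g)) = completions ?a (?b - 1) (m - i)"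
    if g: "g \<in> ?U 1" for g
  proof -
    have "g \<in> {1..<i}"
      using g by (simp add: stolen_times_def)
    moreover have "?b > 0"
      using g by (auto simp: card_gt_0_iff)
    ultimately show ?thesis
      using less.hyps[of i "steal_state g s"] less.prems card_stolen_times_steal_state_1[OF g]
      by (simp add: valid_steal_state)
  qed
  have take: "finite ?T \<and> real (card ?T) =
      (case m - i of 0 \<Rightarrow> 1 | Suc r' \<Rightarrow> completions (Suc ?a) ?b r')"
  proof (cases "i = m")
    case True
    \<comment> \<open>Taking the last gift leaves only the empty continuation; the induction
      hypothesis does not cover the index \<open>Suc m\<close>.\<close>
    then show ?thesis
      using ordered_completions_end valid_take_state[OF less.prems] by simp
  next
    case False
    then have "m - i = Suc (m - Suc i)"
      using less.prems(2) by simp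
    moreover have "i \<notin> ?U 0"
      by (simp add: stolen_times_def)
    ultimately show ?thesis
      using less.hyps[of "Suc i" "take_state i s"] False less.prems
      by (simp add: valid_take_state stolen_times_take_state[OF less.prems(1), simplified])
  qed
  define S where "S = (\<Union>g\<in>?U 0 \<union> ?U 1. Cons (Steal g) ` ?C g)"
  have fin: "finite (?C g)" if "g \<in> ?U 0 \<union> ?U 1" for g
    using that steal_0 steal_1 by blast
  have "finite S"
    unfolding S_def using fin by auto
  \<comment> \<open>The pieces are disjoint since their scenarios differ in the first move.\<close>
  have "card S = (\<Sum>g\<in>?U 0 \<union> ?U 1. card (Cons (Steal g) ` ?C g))"
    unfolding S_def using fin by (intro card_UN_disjoint) auto
  also have "\<dots> = (\<Sum>g\<in>?U 0 \<union> ?U 1. card (?C g))"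
    by (intro sum.cong card_image) auto
  also have "\<dots> = (\<Sum>g\<in>?U 0. card (?C g)) + (\<Sum>g\<in>?U 1. card (?C g))"
    by (intro sum.union_disjoint disj) simp_all
  finally have card_S: "real (card S) =
      real ?a * completions (?a - 1) (Suc ?b) (m - i) + real ?b * completions ?a (?b - 1) (m - i)"
    using steal_0 steal_1 by simp
  have step: "ordered_completions m i s = Cons (Take i) ` ?T \<union> S"
    unfolding S_def by (rule ordered_completions_step[OF less.prems])
  have "card (ordered_completions m i s) = card (Cons (Take i) ` ?T) + card S"
    unfolding step using take \<open>finite S\<close> by (intro card_Un_disjoint) (auto simp: S_def)
  also have "card (Cons (Take i) ` ?T) = card ?T"
    by (rule card_image) simp
  finally show ?case
    using take card_S \<open>finite S\<close> completions_rec[of ?a ?b "m - i"] by (simp add: step)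
qed

section \<open>The values of \<open>G2\<close>\<close>

lemma valid_initial_state: "valid_state m 1 (initial_state m)"
  by (simp add: valid_state_def initial_state_def)

text \<open>At the start no gift is unwrapped and n + 1 are in the pool, so a = b = 0 and r =
  n.\<close>

lemma G2_eq_laplace: "real (G2 n) = laplace (partition_egf n)"
proof -
  have "{ms \<in> scenarios 2 (n + 1). taken_gifts ms = [1..<n + 2]} =
      ordered_completions (n + 1) 1 (initial_state (n + 1))"
    by (simp add: scenarios_def ordered_completions_def)
  then show ?thesis
    using card_ordered_completions[OF valid_initial_state, of "n + 1"]
    by (simp add: G2_def stolen_times_def completions_def)
qed

lemma G2_small: "G2 0 = 1" "G2 1 = 3" "G2 2 = 31" "G2 3 = 842"
proof -
  have "real (G2 0) = 1" "real (G2 1) = 3" "real (G2 2) = 31" "real (G2 3) = 842"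
    unfolding G2_eq_laplace
    \<comment> \<open>For example, n = 1 gives 1! + 2!/2 + 3!/6 = 3.\<close>
    by (simp_all add: partition_egf_def block_egf_def laplace_def egf_coeff_def eval_nat_numeral)
  then show "G2 0 = 1" "G2 1 = 3" "G2 2 = 31" "G2 3 = 842"
    by linarith+
qed

theorem theorem6:
  shows "(\<forall>n k :: int. n \<ge> 4 \<longrightarrow>
      real (E2 n k) =
        (9 * of_int n ^ 2 - 9 * of_int n + 2) / 2 * real (E2 (n - 1) (k - 3))
        - 5 / 2 * real (E2 (n - 1) (k - 1))
        + (9 * of_int n ^ 2 - 36 * of_int n + 35) / 2 * real (E2 (n - 2) (k - 4))
        + 6 * (of_int n - 1) * real (E2 (n - 2) (k - 3))
        - 3 / 2 * real (E2 (n - 2) (k - 2))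
        + 3 * (2 * of_int n - 5) * real (E2 (n - 3) (k - 4))
        + 5 / 2 * real (E2 (n - 3) (k - 3))
        + 5 / 2 * real (E2 (n - 4) (k - 4)))
    \<and> (\<forall>n :: nat. n \<ge> 4 \<longrightarrow>
      real (G2 n) =
        (9 * real n ^ 2 - 9 * real n - 3) / 2 * real (G2 (n - 1))
        + (9 * real n ^ 2 - 24 * real n + 20) / 2 * real (G2 (n - 2))
        + (6 * real n - 25 / 2) * real (G2 (n - 3))
        + 5 / 2 * real (G2 (n - 4)))
    \<and> G2 0 = 1 \<and> G2 1 = 3 \<and> G2 2 = 31 \<and> G2 3 = 842"
  unfolding G2_eq_laplace
  by (intro conjI allI impI E2_recurrence laplace_partition_egf_recurrence G2_small)

end
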